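(* Let $\mathcal{F}$ be a family of pairs $(f,g)$ of non-negative measurable functions on $\mathbb{R}^n$. Assume that for some $p_0,q_0,\delta$ with $0<p_0\le q_0<\infty$, $0<\delta<1$, and every weight $w\in A_1$, $$\left(\int_{\mathbb{R}^n}f(x)^{q_0}w(x)^{\delta}dx\right)^{1/q_0}\le C_0\left(\int_{\mathbb{R}^n}g(x)^{p_0}w(x)^{\delta p_0/q_0}dx\right)^{1/p_0},\qquad (f,g)\in\mathcal{F}$$ (understood in the sense explained in the context). Let $p(\cdot)\in\mathcal{P}^0$ be such that $p_0<p^-\le p^+<\frac{p_0q_0}{q_0-\delta p_0}$, and define the function $q(\cdot)$ by $$\frac1{p(x)}-\frac1{q(x)}=\frac1{p_0}-\frac1{q_0},\qquad x\in\mathbb{R}^n.$$ If $\delta\,(q(\cdot)/q_0)'\in\mathcal{B}(\mathbb{R}^n)$, then there is a constant $C$ such that for all $(f,g)\in\mathcal{F}$ with $f\in L^{q(\cdot)}(\mathbb{R}^n)$, $$\|f\|_{q(\cdot)}\le C\|g\|_{p(\cdot)}.$$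
   Context: For a measurable $p:\mathbb{R}^n\to(0,\infty)$ put $p^-=\operatorname{ess\,inf}_{x}p(x)$, $p^+=\operatorname{ess\,sup}_{x}p(x)$. $\mathcal{P}^0$ is the set of measurable $p:\mathbb{R}^n\to(0,\infty)$ with $p^->0$ and $p^+<\infty$. Variable Lebesgue space: for measurable $p:\mathbb{R}^n\to[1,\infty)$, $L^{p(\cdot)}(\mathbb{R}^n)$ is the set of measurable $f$ such that $\int_{\mathbb{R}^n}(|f(x)|/\lambda)^{p(x)}dx<\infty$ for some $\lambda>0$, with norm $\|f\|_{p(\cdot)}=\inf\{\lambda>0:\int_{\mathbb{R}^n}(|f(x)|/\lambda)^{p(x)}dx\le1\}$. For $p(\cdot)\in\mathcal{P}^0$, $L^{p(\cdot)}(\mathbb{R}^n)$ is the set of measurable $f$ with $|f|^{s}\in L^{p(\cdot)/s}(\mathbb{R}^n)$, where $0<s<p^-$, with quasi-norm $\|f\|_{p(\cdot)}=\||f|^{s}\|_{p(\cdot)/s}^{1/s}$ (independent of $s$). A norm is taken to be $+\infty$ if the function is not in the space. Conjugate exponent: $r'(\cdot)$ is defined pointwise by $1/r(x)+1/r'(x)=1$. $\mathcal{B}(\mathbb{R}^n)$ is the set of exponents $r:\mathbb{R}^n\to[1,\infty)$ (measurable) such that the Hardy–Littlewood maximal operator $Mf(x)=\sup_{\rho>0}\frac1{|B(x,\rho)|}\int_{B(x,\rho)}|f(y)|dy$ is bounded on $L^{r(\cdot)}(\mathbb{R}^n)$. A weight is a non-negative locally integrable function $w$ on $\mathbb{R}^n$.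 $w\in A_1$ means there is a constant $C$ such that for every cube $Q\subset\mathbb{R}^n$, $\frac1{|Q|}\int_Q w\,dx\le C\operatorname{ess\,inf}_{x\in Q}w(x)$; the smallest such $C$ is the $A_1$ constant of $w$. Convention: saying that the weighted inequality holds for $(f,g)\in\mathcal{F}$ and $w\in A_1$ means that it holds for any pair in $\mathcal{F}$ for which its left-hand side is finite, with a constant $C_0$ depending only on the exponents $p_0,q_0$ and the $A_1$ constant of $w$ (here $\delta$ and $\mathcal{F}$ are fixed). *)

theory Defs
  imports "HOL-Analysis.Analysis" "HOL-Probability.Essential_Supremum"
begin

section \<open>Preliminaries\<close>

text \<open>Powers of extended non-negative numbers, intended for exponents \<open>a > 0\<close> only,
  with \<open>\<infinity>\<close> raised to \<open>a\<close> being \<open>\<infinity>\<close>.\<close>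

definition ennreal_rpow :: "ennreal \<Rightarrow> real \<Rightarrow> ennreal" (infixr "erpow" 80)
  where "x erpow a = (if x = \<infinity> then \<infinity> else ennreal (enn2real x powr a))"

definition essinf :: "'a measure \<Rightarrow> ('a \<Rightarrow> ereal) \<Rightarrow> ereal"
  where "essinf M f = - esssup M (\<lambda>x. - f x)"

definition exp_minus :: "(real^'n \<Rightarrow> real) \<Rightarrow> ereal"
  where "exp_minus p = essinf lebesgue (\<lambda>x. ereal (p x))"

definition exp_plus :: "(real^'n \<Rightarrow> real) \<Rightarrow> ereal"
  where "exp_plus p = esssup lebesgue (\<lambda>x. ereal (p x))"

definition exponents0 :: "(real^'n \<Rightarrow> real) set"  (* the class P^0 *)
  where "exponents0 = {p \<in> borel_measurable lebesgue.
           (\<forall>x. 0 < p x) \<and> 0 < exp_minus p \<and> exp_plus p < \<infinity>}"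

text \<open>This is \<open>1/r(x) + 1/r'(x) = 1\<close> solved for \<open>r'(x)\<close>. Where \<open>r(x) = 1\<close>, so that
  mathematically \<open>r'(x) = \<infinity>\<close>, the formula returns the junk value \<open>0\<close>.\<close>

definition conj_exponent :: "(real^'n \<Rightarrow> real) \<Rightarrow> real^'n \<Rightarrow> real"
  where "conj_exponent r x = 1 / (1 - 1 / r x)"

section \<open>Variable Lebesgue spaces\<close>

definition modular :: "(real^'n \<Rightarrow> real) \<Rightarrow> (real^'n \<Rightarrow> real) \<Rightarrow> ennreal"
  where "modular p f = (\<integral>\<^sup>+x. ennreal (\<bar>f x\<bar> powr p x) \<partial>lebesgue)"

text \<open>The space and norm for exponents with values in \<open>[1,\<infinity>)\<close>.\<close>

definition var_Lp :: "(real^'n \<Rightarrow> real) \<Rightarrow> (real^'n \<Rightarrow> real) set"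
  where "var_Lp p = {f \<in> borel_measurable lebesgue. \<exists>c>0. modular p (\<lambda>x. f x / c) < \<infinity>}"

definition var_norm :: "(real^'n \<Rightarrow> real) \<Rightarrow> (real^'n \<Rightarrow> real) \<Rightarrow> ennreal"
  where "var_norm p f =
    (if f \<in> var_Lp p then Inf (ennreal ` {c. 0 < c \<and> modular p (\<lambda>x. f x / c) \<le> 1}) else \<infinity>)"

text \<open>The space and quasi-norm for exponents in \<^const>\<open>exponents0\<close>, first with an explicit
  auxiliary parameter \<open>s\<close>, then with the choice \<open>s = p\<^sup>-/2\<close>. The lemmas \<open>var_Lp_aux_indep\<close> and
  \<open>var_norm_aux_indep\<close> below show that the choice of \<open>s\<close> is immaterial.\<close>

definition var_Lp_aux :: "real \<Rightarrow> (real^'n \<Rightarrow> real) \<Rightarrow> (real^'n \<Rightarrow> real) set"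
  where "var_Lp_aux s p =
    {f \<in> borel_measurable lebesgue. (\<lambda>x. \<bar>f x\<bar> powr s) \<in> var_Lp (\<lambda>x. p x / s)}"

definition var_norm_aux :: "real \<Rightarrow> (real^'n \<Rightarrow> real) \<Rightarrow> (real^'n \<Rightarrow> real) \<Rightarrow> ennreal"
  where "var_norm_aux s p f =
    (if f \<in> var_Lp_aux s p then var_norm (\<lambda>x. p x / s) (\<lambda>x. \<bar>f x\<bar> powr s) erpow (1 / s) else \<infinity>)"

definition var_Lp0 :: "(real^'n \<Rightarrow> real) \<Rightarrow> (real^'n \<Rightarrow> real) set"
  where "var_Lp0 p = var_Lp_aux (real_of_ereal (exp_minus p) / 2) p"

definition var_norm0 :: "(real^'n \<Rightarrow> real) \<Rightarrow> (real^'n \<Rightarrow> real) \<Rightarrow> ennreal"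
  where "var_norm0 p f = var_norm_aux (real_of_ereal (exp_minus p) / 2) p f"

lemma modular_rescale:
  assumes "s > 0" "l > 0"
  shows "modular (\<lambda>x. p x / s) (\<lambda>x. \<bar>f x\<bar> powr s / l) = modular p (\<lambda>x. f x / l powr (1/s))"
proof -
  have "\<bar>\<bar>f x\<bar> powr s / l\<bar> powr (p x / s) = \<bar>f x / l powr (1/s)\<bar> powr p x" for x
  proof -
    have "\<bar>\<bar>f x\<bar> powr s / l\<bar> = \<bar>f x / l powr (1/s)\<bar> powr s"
      using assms by (simp add: powr_divide powr_powr abs_divide)
    then show ?thesis
      using assms by (simp add: powr_powr)
  qed
  then show ?thesis by (simp add: modular_def)
qed

lemma var_Lp_aux_eq:
  assumes "s > 0"
  shows "var_Lp_aux s p = var_Lp p"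
proof -
  have "(\<exists>l>0. modular (\<lambda>x. p x / s) (\<lambda>x. \<bar>f x\<bar> powr s / l) < \<infinity>)
      \<longleftrightarrow> (\<exists>l>0. modular p (\<lambda>x. f x / l) < \<infinity>)" for f
  proof
    assume "\<exists>l>0. modular (\<lambda>x. p x / s) (\<lambda>x. \<bar>f x\<bar> powr s / l) < \<infinity>"
    then obtain l where "l > 0" "modular p (\<lambda>x. f x / l powr (1/s)) < \<infinity>"
      using modular_rescale[OF assms] by metis
    then show "\<exists>l>0. modular p (\<lambda>x. f x / l) < \<infinity>"
      by (intro exI[of _ "l powr (1/s)"]) simp
  next
    assume "\<exists>l>0. modular p (\<lambda>x. f x / l) < \<infinity>"
    then obtain l where l: "l > 0" "modular p (\<lambda>x. f x / l) < \<infinity>" by blast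
    have "modular (\<lambda>x. p x / s) (\<lambda>x. \<bar>f x\<bar> powr s / l powr s) = modular p (\<lambda>x. f x / l)"
      using modular_rescale[OF assms, of "l powr s" p f] l assms by (simp add: powr_powr)
    with l show "\<exists>l>0. modular (\<lambda>x. p x / s) (\<lambda>x. \<bar>f x\<bar> powr s / l) < \<infinity>"
      by (intro exI[of _ "l powr s"]) simp
  qed
  then show ?thesis
    by (auto simp: var_Lp_aux_def var_Lp_def)
qed

lemma erpow_mono: "a > 0 \<Longrightarrow> x \<le> y \<Longrightarrow> x erpow a \<le> y erpow a"
  unfolding ennreal_rpow_def
  by (cases x; cases y) (auto simp: ennreal_le_iff top_unique intro!: powr_mono2 ennreal_leI)

lemma erpow_erpow: "a > 0 \<Longrightarrow> (x erpow a) erpow (1/a) = x"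
  unfolding ennreal_rpow_def by (cases x) (auto simp: powr_powr)

lemma erpow_Inf:
  assumes "a > 0"
  shows "Inf A erpow a = Inf ((\<lambda>x. x erpow a) ` A)"
proof (rule antisym)
  show "Inf A erpow a \<le> Inf ((\<lambda>x. x erpow a) ` A)"
    by (auto intro!: INF_greatest erpow_mono[OF assms] Inf_lower)
  have "Inf ((\<lambda>x. x erpow a) ` A) erpow (1/a) \<le> Inf A"
  proof (rule Inf_greatest)
    fix x assume "x \<in> A"
    then have "Inf ((\<lambda>x. x erpow a) ` A) erpow (1/a) \<le> (x erpow a) erpow (1/a)"
      using assms by (intro erpow_mono INF_lower) auto
    then show "Inf ((\<lambda>x. x erpow a) ` A) erpow (1/a) \<le> x"
      by (simp add: erpow_erpow assms)
  qed
  then have "(Inf ((\<lambda>x. x erpow a) ` A) erpow (1/a)) erpow a \<le> Inf A erpow a"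
    by (rule erpow_mono[OF assms])
  then show "Inf ((\<lambda>x. x erpow a) ` A) \<le> Inf A erpow a"
    using erpow_erpow[of "1/a"] assms by simp
qed

lemma var_norm_aux_eq:
  assumes "s > 0"
  shows "var_norm_aux s p f = var_norm p f"
proof (cases "f \<in> var_Lp p")
  case False
  then show ?thesis by (simp add: var_norm_aux_def var_norm_def var_Lp_aux_eq assms)
next
  case True
  let ?A = "{l. 0 < l \<and> modular (\<lambda>x. p x / s) (\<lambda>x. \<bar>f x\<bar> powr s / l) \<le> 1}"
  let ?B = "{l. 0 < l \<and> modular p (\<lambda>x. f x / l) \<le> 1}"
  have mem: "(\<lambda>x. \<bar>f x\<bar> powr s) \<in> var_Lp (\<lambda>x. p x / s)"
    using True var_Lp_aux_eq[OF assms, of p] by (auto simp: var_Lp_aux_def)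
  have "(\<lambda>l. l powr (1/s)) ` ?A = ?B"
  proof (intro equalityI subsetI)
    fix l assume "l \<in> (\<lambda>l. l powr (1/s)) ` ?A"
    then obtain k where "k \<in> ?A" "l = k powr (1/s)" by blast
    then show "l \<in> ?B" using modular_rescale[OF assms, of k p f] by auto
  next
    fix l assume l: "l \<in> ?B"
    then have "l = (l powr s) powr (1/s)" "l powr s \<in> ?A"
      using modular_rescale[OF assms, of "l powr s" p f] assms by (auto simp: powr_powr)
    then show "l \<in> (\<lambda>l. l powr (1/s)) ` ?A" by blast
  qed
  moreover have "(\<lambda>x. x erpow (1/s)) ` (ennreal ` ?A) = ennreal ` (\<lambda>l. l powr (1/s)) ` ?A"
    unfolding image_image by (rule image_cong) (auto simp: ennreal_rpow_def)
  ultimately have "(\<lambda>x. x erpow (1/s)) ` (ennreal ` ?A) = ennreal ` ?B"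
    by simp
  then show ?thesis
    using True mem assms
    by (simp add: var_norm_aux_def var_norm_def var_Lp_aux_eq erpow_Inf)
qed

lemma var_Lp_aux_indep: "s > 0 \<Longrightarrow> t > 0 \<Longrightarrow> var_Lp_aux s p = var_Lp_aux t p"
  by (simp add: var_Lp_aux_eq)

lemma var_norm_aux_indep: "s > 0 \<Longrightarrow> t > 0 \<Longrightarrow> var_norm_aux s p f = var_norm_aux t p f"
  by (simp add: var_norm_aux_eq)

section \<open>The maximal operator and the class of admissible exponents\<close>

definition maximal_function :: "(real^'n \<Rightarrow> real) \<Rightarrow> real^'n \<Rightarrow> ennreal"
  where "maximal_function f x =
    (SUP \<rho>\<in>{0<..}. (\<integral>\<^sup>+y\<in>ball x \<rho>. ennreal \<bar>f y\<bar> \<partial>lebesgue) / emeasure lebesgue (ball x \<rho>))"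

text \<open>As \<^const>\<open>var_norm\<close> is infinite off the space, the norm inequality includes
  \<open>M f \<in> L\<^sup>r\<close>. The passage to \<^typ>\<open>real\<close> would hide points with \<open>M f(x) = \<infinity>\<close>,
  so almost-everywhere finiteness is demanded separately.\<close>

definition maximal_bounded_exponents :: "(real^'n \<Rightarrow> real) set"  (* the class B(R^n) *)
  where "maximal_bounded_exponents = {r \<in> borel_measurable lebesgue. (\<forall>x. 1 \<le> r x) \<and>
    (\<exists>C::real. \<forall>f\<in>var_Lp r. (AE x in lebesgue. maximal_function f x < \<infinity>) \<and>
       var_norm r (\<lambda>x. enn2real (maximal_function f x)) \<le> ennreal C * var_norm r f)}"

section \<open>Weights\<close>

definition weight :: "(real^'n \<Rightarrow> real) \<Rightarrow> bool"
  where "weight w \<longleftrightarrow> w \<in> borel_measurable lebesgue \<and> (\<forall>x. 0 \<le> w x) \<and>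
    (\<forall>K. compact K \<longrightarrow> set_integrable lebesgue K w)"

definition cube :: "(real^'n) set \<Rightarrow> bool"
  where "cube Q \<longleftrightarrow> (\<exists>a l. 0 < l \<and> Q = cbox a (a + (\<chi> i. l)))"

definition A1_bound :: "(real^'n \<Rightarrow> real) \<Rightarrow> real \<Rightarrow> bool"
  where "A1_bound w C \<longleftrightarrow> (\<forall>Q. cube Q \<longrightarrow>
    ereal ((LINT x:Q|lebesgue. w x) / measure lebesgue Q)
      \<le> ereal C * essinf (lebesgue_on Q) (\<lambda>x. ereal (w x)))"

definition A1_weight :: "(real^'n \<Rightarrow> real) \<Rightarrow> bool"
  where "A1_weight w \<longleftrightarrow> weight w \<and> (\<exists>C. A1_bound w C)"

text \<open>Non-negativity of \<open>C\<close> only matters for \<open>w = 0\<close>, where every real \<open>C\<close> is a bound.\<close>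

definition A1_const :: "(real^'n \<Rightarrow> real) \<Rightarrow> real"
  where "A1_const w = Inf {C. 0 \<le> C \<and> A1_bound w C}"

end

theory Submission
  imports Defs
begin

text \<open>
  Rubio de Francia extrapolation. With \<open>s = \<delta> (q/q\<^sub>0)'\<close>, the pointwise requirement
  \<open>s \<ge> 1\<close> forces \<open>q\<^sub>0 < q \<le> q\<^sub>0 / (1 - \<delta>)\<close> everywhere. A function \<open>f\<close> normalised to
  have modular about \<open>1\<close> in \<open>L\<^sup>q\<close> is tested against \<open>h = f\<close> raised to \<open>q - q\<^sub>0\<close>, which replaces
  duality; \<open>h\<close> raised to \<open>1/\<delta>\<close> lies in \<open>L\<^sup>s\<close> and is majorised by an \<open>A\<^sub>1\<close> weight \<open>w\<close> in \<open>L\<^sup>s\<close>.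
  Young's inequality bounds the right-hand side of the weighted estimate and makes its
  left-hand side finite.

  As \<open>C\<^sub>0\<close> is an arbitrary, possibly unbounded, function of the \<open>A\<^sub>1\<close> constant, weights depending
  on \<open>f\<close> would not give a uniform bound. Instead, a sequence of pairs violating the conclusion
  with geometrically growing constants is treated with one weight that majorises all the
  test functions, up to factors \<open>4\<^sup>k\<close>.
\<close>


section \<open>Modulars and the Luxemburg norm\<close>

lemma modular_mono:
  assumes "\<And>x. 0 \<le> p x" and "AE x in lebesgue. \<bar>f x\<bar> \<le> \<bar>g x\<bar>"
  shows "modular p f \<le> modular p g"
  unfolding modular_def
  by (rule nn_integral_mono_AE, rule AE_mp[OF assms(2)])
     (auto intro!: AE_I2 ennreal_leI powr_mono2 assms(1))

lemma modular_cmult_le: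
  assumes [measurable]: "p \<in> borel_measurable lebesgue" "f \<in> borel_measurable lebesgue"
    and "\<And>x. \<bar>c\<bar> powr p x \<le> b" "0 \<le> b"
  shows "modular p (\<lambda>x. c * f x) \<le> ennreal b * modular p f"
  unfolding modular_def
  by (subst nn_integral_cmult[symmetric], measurable)
     (auto intro!: nn_integral_mono ennreal_leI mult_right_mono assms
       simp: abs_mult powr_mult ennreal_mult'[symmetric] assms(4))

lemma var_norm_lessD:
  assumes "\<And>x. 0 \<le> p x" "0 < b" "var_norm p f < ennreal b"
  shows "f \<in> borel_measurable lebesgue" "modular p (\<lambda>x. f x / b) \<le> 1"
proof -
  have f: "f \<in> var_Lp p"
    using assms(3) by (auto simp: var_norm_def split: if_splits)
  then show "f \<in> borel_measurable lebesgue" by (simp add: var_Lp_def)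
  from f assms(3) obtain c where c: "0 < c" "modular p (\<lambda>x. f x / c) \<le> 1" "ennreal c < ennreal b"
    by (auto simp: var_norm_def Inf_less_iff)
  then have "c < b" by (simp add: ennreal_less_iff)
  have "modular p (\<lambda>x. f x / b) \<le> modular p (\<lambda>x. f x / c)"
    using \<open>c < b\<close> \<open>0 < c\<close> by (intro modular_mono assms AE_I2) (auto intro!: divide_left_mono)
  with c show "modular p (\<lambda>x. f x / b) \<le> 1" by auto
qed

lemma var_norm_leI:
  assumes "f \<in> borel_measurable lebesgue" "0 < b" "modular p (\<lambda>x. f x / b) \<le> 1"
  shows "f \<in> var_Lp p" "var_norm p f \<le> ennreal b"
proof -
  have "modular p (\<lambda>x. f x / b) < \<infinity>"
    using assms(3) by (rule le_less_trans) simp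
  with assms show "f \<in> var_Lp p" by (auto simp: var_Lp_def)
  with assms show "var_norm p f \<le> ennreal b"
    by (auto simp: var_norm_def intro!: Inf_lower)
qed

text \<open>As \<open>p\<close> is at least \<open>a\<close>, a factor t \<le> 1 shrinks the modular
  by at least \<open>t powr a\<close>. A finite modular can thus be brought down to 1 by enlarging
  the divisor.\<close>

lemma var_norm_finite:
  assumes [measurable]: "p \<in> borel_measurable lebesgue"
    and p: "\<And>x. a \<le> p x" "0 < a" and f: "f \<in> var_Lp p"
  shows "var_norm p f < \<infinity>"
proof -
  have [measurable]: "f \<in> borel_measurable lebesgue" using f by (simp add: var_Lp_def)
  obtain c where c: "c > 0" "modular p (\<lambda>x. f x / c) < \<infinity>"
    using f by (auto simp: var_Lp_def)
  define m where "m = enn2real (modular p (\<lambda>x. f x / c)) + 1"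
  have m: "modular p (\<lambda>x. f x / c) \<le> ennreal m" "1 \<le> m"
    using c(2) by (cases "modular p (\<lambda>x. f x / c)") (auto simp: m_def intro: ennreal_leI)
  define t where "t = (1 / m) powr (1 / a)"
  have t: "0 < t" "t \<le> 1" "t powr a = 1 / m"
    using m(2) p(2) by (auto simp: t_def powr_powr intro!: powr_le1)
  have "modular p (\<lambda>x. t * (f x / c)) \<le> ennreal (1 / m) * modular p (\<lambda>x. f x / c)"
    using t p(1) m(2) by (intro modular_cmult_le) (auto simp flip: t(3) intro!: powr_mono')
  also have "\<dots> \<le> ennreal (1 / m) * ennreal m" by (intro mult_left_mono m) simp
  also have "\<dots> = 1" using m(2) by (simp flip: ennreal_mult' )
  finally have "modular p (\<lambda>x. f x / (c / t)) \<le> 1" by (simp add: ac_simps)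
  then have "var_norm p f \<le> ennreal (c / t)"
    using c t by (intro var_norm_leI) auto
  then show ?thesis by (rule le_less_trans) simp
qed

text \<open>Take an admissible divisor \<open>c\<close> below twice the norm, which is possible
  because the norm is positive, and \<open>l = c / 2\<close>. Then \<open>l\<close> lies below the
  norm, so the modular at \<open>l\<close> exceeds 1, while halving the divisor costs at most the
  factor \<open>2 powr b\<close>.\<close>

lemma var_norm_near_extremal:
  assumes [measurable]: "p \<in> borel_measurable lebesgue"
    and p: "\<And>x. a \<le> p x" "\<And>x. p x \<le> b" "0 < a" and f: "f \<in> var_Lp p" "0 < var_norm p f"
  obtains l where "0 < l" "var_norm p f \<le> ennreal (2 * l)"
    "1 \<le> modular p (\<lambda>x. f x / l)" "modular p (\<lambda>x. f x / l) \<le> ennreal (2 powr b)"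
proof -
  have [measurable]: "f \<in> borel_measurable lebesgue" using f by (simp add: var_Lp_def)
  have p0: "0 \<le> p x" for x using p(1)[of x] p(3) by linarith
  obtain v where v: "var_norm p f = ennreal v" "0 < v"
    using var_norm_finite[OF assms(1) p(1,3) f(1)] f(2) by (cases "var_norm p f") auto
  then have less: "var_norm p f < ennreal (2 * v)" by (simp add: ennreal_less_iff)
  then obtain c where c: "0 < c" "modular p (\<lambda>x. f x / c) \<le> 1" "ennreal c < ennreal (2 * v)"
    using f by (auto simp: var_norm_def Inf_less_iff)
  then have "c < 2 * v" by (simp add: ennreal_less_iff)
  show thesis
  proof (rule that[of "c / 2"])
    show "0 < c / 2" using c by simp
    show "var_norm p f \<le> ennreal (2 * (c / 2))"
      using c by (simp add: var_norm_leI)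
    show "1 \<le> modular p (\<lambda>x. f x / (c / 2))"
    proof (rule ccontr)
      assume "\<not> ?thesis"
      then have "var_norm p f \<le> ennreal (c / 2)" using c by (intro var_norm_leI) auto
      with \<open>c < 2 * v\<close> v c show False by simp
    qed
    have "modular p (\<lambda>x. 2 * (f x / c)) \<le> ennreal (2 powr b) * modular p (\<lambda>x. f x / c)"
      using p by (intro modular_cmult_le) auto
    also have "\<dots> \<le> ennreal (2 powr b) * 1" by (intro mult_left_mono c) simp
    finally show "modular p (\<lambda>x. f x / (c / 2)) \<le> ennreal (2 powr b)" by (simp add: ac_simps)
  qed
qed

text \<open>A pointwise argument replaces the triangle inequality: if \<open>T\<close> is the sum of
  the \<open>s\<close>-th powers, each \<open>a k\<close> is at most \<open>T\<close> to the power
  1/s, and so is their average \<open>W\<close>, whose coefficients sum to 1. Integrating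
  \<open>T\<close> gives the geometric series with sum 2.\<close>

lemma modular_suminf:
  fixes a :: "nat \<Rightarrow> real^'n \<Rightarrow> real"
  assumes [measurable]: "s \<in> borel_measurable lebesgue" "\<And>k. a k \<in> borel_measurable lebesgue"
    and s: "\<And>x. 0 < s x" and a: "\<And>k x. 0 \<le> a k x"
    and m: "\<And>k. modular s (a k) \<le> ennreal ((1/2)^k)"
  defines "W \<equiv> \<lambda>x. \<Sum>k. ennreal ((1/2)^Suc k * a k x)"
  shows "AE x in lebesgue. W x < \<infinity>" "modular s (\<lambda>x. enn2real (W x)) \<le> 2"
proof -
  define T where "T x = (\<Sum>k. ennreal (a k x powr s x))" for x
  have [measurable]: "T \<in> borel_measurable lebesgue" unfolding T_def by measurable
  have "(\<integral>\<^sup>+x. T x \<partial>lebesgue) = (\<Sum>k. modular s (a k))"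
    unfolding T_def modular_def by (subst nn_integral_suminf) (auto simp: a)
  also have "\<dots> \<le> (\<Sum>k. ennreal ((1/2)^k))" by (intro suminf_le m) auto
  also have "\<dots> = ennreal 2"
    by (subst suminf_ennreal_eq[of _ 2]) (use geometric_sums[of "1/2::real"] in auto)
  finally have T: "(\<integral>\<^sup>+x. T x \<partial>lebesgue) \<le> 2" by simp
  have W: "W x < \<infinity> \<and> enn2real (W x) powr s x \<le> enn2real (T x)" if "T x < \<infinity>" for x
  proof -
    define t where "t = enn2real (T x)"
    have t: "T x = ennreal t" "0 \<le> t" using that by (simp_all add: t_def)
    have "a k x \<le> t powr (1 / s x)" for k
    proof -
      have "ennreal (a k x powr s x) \<le> T x"
        using sum_le_suminf[OF summableI, of "{k}" "\<lambda>k. ennreal (a k x powr s x)"]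
        by (simp only: T_def[symmetric] sum.insert sum.empty finite.intros empty_iff add_0_right)
           simp
      then have "a k x powr s x \<le> t" using t by simp
      then have "(a k x powr s x) powr (1 / s x) \<le> t powr (1 / s x)"
        using s[of x] by (intro powr_mono2) auto
      then show ?thesis using s[of x] a[of k x] by (simp add: powr_powr)
    qed
    then have "W x \<le> (\<Sum>k. ennreal ((1/2)^Suc k * t powr (1 / s x)))"
      unfolding W_def by (intro suminf_le ennreal_leI mult_left_mono) auto
    also have "\<dots> = ennreal (1 * t powr (1 / s x))"
      by (rule suminf_ennreal_eq[OF _ sums_mult2[OF power_half_series]]) simp
    finally have Wx: "W x \<le> ennreal (t powr (1 / s x))" by simp
    then have "enn2real (W x) \<le> t powr (1 / s x)" by (rule enn2real_leI[rotated]) simp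
    then have "enn2real (W x) powr s x \<le> (t powr (1 / s x)) powr s x"
      using s[of x] by (intro powr_mono2) auto
    with Wx s[of x] t show ?thesis by (auto simp: powr_powr t_def[symmetric] intro: le_less_trans)
  qed
  have "AE x in lebesgue. T x \<noteq> \<infinity>"
    by (rule nn_integral_PInf_AE) (use T in \<open>auto simp: top_unique\<close>)
  then show "AE x in lebesgue. W x < \<infinity>"
    by eventually_elim (use W in \<open>auto simp: top.not_eq_extremum\<close>)
  have "ennreal (\<bar>enn2real (W x)\<bar> powr s x) \<le> T x" for x
    using W[of x] by (cases "T x") (auto intro!: ennreal_leI)
  then have "modular s (\<lambda>x. enn2real (W x)) \<le> (\<integral>\<^sup>+x. T x \<partial>lebesgue)"
    unfolding modular_def by (intro nn_integral_mono)
  with T show "modular s (\<lambda>x. enn2real (W x)) \<le> 2" by (rule order_trans[rotated])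
qed

section \<open>Young's inequality for modulars\<close>

lemma powr_mult_le_add:
  fixes A B t :: real
  assumes "0 \<le> A" "0 \<le> B" "0 \<le> t" "t \<le> 1"
  shows "A powr t * B powr (1 - t) \<le> A + B"
proof (cases "max A B = 0")
  case False
  then have "max A B > 0" using assms by linarith
  \<comment> \<open>Replacing both factors by the larger one gives a crude Young inequality, with
    coefficient 1 in place of \<open>t\<close> and \<open>1 - t\<close>.\<close>
  have "A powr t * B powr (1 - t) \<le> max A B powr t * max A B powr (1 - t)"
    using assms by (intro mult_mono powr_mono2) auto
  also have "\<dots> = max A B" using \<open>max A B > 0\<close> by (simp flip: powr_add)
  finally show ?thesis using assms by linarith
next
  case True
  then have "A = 0" "B = 0" using assms by linarith+
  then show ?thesis by simp
qed

text \<open>Young's inequality with the pointwise exponents p/a and (p/a)'. The condition on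
  \<open>b\<close> says that \<open>s\<close> is \<open>b\<close> times the conjugate of p/a, so the
  second factor becomes the integrand of the modular of \<open>w\<close>.\<close>

lemma nn_integral_powr_mult_le:
  assumes [measurable]: "p \<in> borel_measurable lebesgue" "s \<in> borel_measurable lebesgue"
      "f \<in> borel_measurable lebesgue" "w \<in> borel_measurable lebesgue"
    and nonneg: "\<And>x. 0 \<le> f x" "\<And>x. 0 \<le> w x"
    and a: "0 < a" "\<And>x. a < p x" and b: "\<And>x. s x * (1 - a / p x) = b"
  shows "(\<integral>\<^sup>+x. ennreal (f x powr a * w x powr b) \<partial>lebesgue) \<le> modular p f + modular s w"
proof -
  have "f x powr a * w x powr b \<le> f x powr p x + w x powr s x" for x
    using powr_mult_le_add[of "f x powr p x" "w x powr s x" "a / p x"] a(1) a(2)[of x] b[of x]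
    by (simp add: powr_powr)
  then have "(\<integral>\<^sup>+x. ennreal (f x powr a * w x powr b) \<partial>lebesgue)
      \<le> (\<integral>\<^sup>+x. ennreal (f x powr p x) + ennreal (w x powr s x) \<partial>lebesgue)"
    by (intro nn_integral_mono) (auto simp flip: ennreal_plus intro!: ennreal_leI)
  also have "\<dots> = modular p f + modular s w"
    by (subst nn_integral_add) (auto simp: modular_def nonneg)
  finally show ?thesis .
qed


section \<open>Balls, cubes and \<open>A1\<close> weights from pointwise control of the maximal
  function\<close>

lemma ball_subset_cube:
  fixes x :: "real^'n"
  shows "ball x r \<subseteq> cbox (x - (\<chi> i. r)) ((x - (\<chi> i. r)) + (\<chi> i. 2 * r))"
proof
  fix y assume "y \<in> ball x r"
  then have "\<bar>(y - x) $ i\<bar> \<le> r" for i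
    using component_le_norm_cart[of "y - x" i] by (simp add: dist_norm norm_minus_commute)
  then show "y \<in> cbox (x - (\<chi> i. r)) ((x - (\<chi> i. r)) + (\<chi> i. 2 * r))"
    by (auto simp: mem_box_cart abs_le_iff algebra_simps)
qed

lemma cube_subset_ball:
  fixes a x :: "real^'n"
  assumes "0 < l" "x \<in> cbox a (a + (\<chi> i. l))"
  shows "cbox a (a + (\<chi> i. l)) \<subseteq> ball x (2 * real CARD('n) * l)"
proof
  fix y assume y: "y \<in> cbox a (a + (\<chi> i. l))"
  have "\<bar>(x - y) $ i\<bar> \<le> l" for i
    using assms(2) y by (auto simp: mem_box_cart abs_le_iff) (smt (verit))+
  then have "norm (x - y) \<le> (\<Sum>i\<in>(UNIV::'n set). l)"
    by (intro order_trans[OF norm_le_l1_cart] sum_mono)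
  \<comment> \<open>The factor 2 makes the bound strict, as the ball is open.\<close>
  also have "\<dots> < 2 * real CARD('n) * l" using assms(1) by simp
  finally show "y \<in> ball x (2 * real CARD('n) * l)" by (simp add: dist_norm)
qed

lemma measure_cube:
  fixes a :: "real^'n"
  assumes "0 \<le> l"
  shows "measure lebesgue (cbox a (a + (\<chi> i. l))) = l ^ CARD('n)"
proof -
  have "cbox a (a + (\<chi> i. l)) \<noteq> {}"
    using assms by (auto simp: interval_ne_empty_cart)
  then show ?thesis by (simp add: content_cbox_cart)
qed

lemma maximal_function_ball_le:
  assumes "0 < r"
  shows "(\<integral>\<^sup>+y\<in>ball x r. ennreal \<bar>f y\<bar> \<partial>lebesgue) / emeasure lebesgue (ball x r) \<le> maximal_function f x"
  unfolding maximal_function_def using assms by (intro SUP_upper) simp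

lemma ennreal_inverse_antimono:
  fixes a b :: ennreal
  assumes "a \<le> b"
  shows "inverse b \<le> inverse a"
proof (cases a)
  case (real r)
  show ?thesis
  proof (cases b)
    case (real t)
    then show ?thesis
      using assms \<open>a = ennreal r\<close> \<open>0 \<le> r\<close>
      by (cases "r = 0") (auto simp: inverse_ennreal intro!: ennreal_leI le_imp_inverse_le)
  qed simp
qed (use assms in \<open>simp add: top_unique\<close>)

text \<open>Around any point of a cube there is a ball of comparable volume that contains the cube.
  Hence the average of \<open>w\<close> over the cube is at most a dimensional constant times the
  maximal function there, which \<open>D * w\<close> controls at almost every point.\<close>

lemma A1_weight_if_maximal_function_le:
  fixes w :: "real^'n \<Rightarrow> real"
  assumes [measurable]: "w \<in> borel_measurable lebesgue" and w: "\<And>x. 0 \<le> w x" and D: "0 < D"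
    and M: "AE x in lebesgue. maximal_function w x \<le> ennreal (D * w x)"
  shows "A1_weight w"
proof -
  have int: "set_integrable lebesgue K w" if K: "compact K" for K
  proof -
    \<comment> \<open>One point with finite maximal function gives local integrability: the average
      over a ball around it that contains \<open>K\<close> is finite.\<close>
    have "\<exists>x. maximal_function w x \<le> ennreal (D * w x)"
      using eventually_happens[OF M] by (simp add: ae_filter_eq_bot_iff)
    then obtain x where x: "maximal_function w x \<le> ennreal (D * w x)" by blast
    obtain r where r: "0 < r" "K \<subseteq> ball x r"
      using bounded_subset_ballD[OF compact_imp_bounded[OF K]] by blast
    have "(\<integral>\<^sup>+y\<in>ball x r. ennreal \<bar>w y\<bar> \<partial>lebesgue) / emeasure lebesgue (ball x r) < \<infinity>"
      by (rule le_less_trans[OF maximal_function_ball_le[OF r(1)]]) (rule le_less_trans[OF x], simp)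
    moreover have "emeasure lebesgue (ball x r) < \<infinity>" by (simp add: emeasure_lborel_ball_finite[unfolded infinity_ennreal_def])
    ultimately have "(\<integral>\<^sup>+y\<in>ball x r. ennreal \<bar>w y\<bar> \<partial>lebesgue) < \<infinity>"
      by (auto simp: ennreal_divide_eq_top_iff top.not_eq_extremum[symmetric])
    moreover have "(\<integral>\<^sup>+y. ennreal (norm (indicator K y *\<^sub>R w y)) \<partial>lebesgue)
        \<le> (\<integral>\<^sup>+y\<in>ball x r. ennreal \<bar>w y\<bar> \<partial>lebesgue)"
      using r(2) by (intro nn_integral_mono) (auto simp: indicator_def)
    ultimately show ?thesis
      using K unfolding set_integrable_def
      by (intro integrableI_bounded) (auto dest: lmeasurable_compact intro: le_less_trans)
  qed
  define n where "n = CARD('n)"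
  \<comment> \<open>The ball of radius 2nl used below fits into a cube of side 4nl, whose volume is
    (4n)^n times that of \<open>Q\<close>.\<close>
  define C where "C = D * (4 * real n) ^ n"
  have n: "0 < n" by (simp add: n_def)
  have C: "0 < C" using D n by (simp add: C_def)
  have "A1_bound w C"
    unfolding A1_bound_def
  proof (intro allI impI)
    fix Q :: "(real^'n) set" assume "cube Q"
    then obtain a l where l: "0 < l" and Q: "Q = cbox a (a + (\<chi> i. l))" unfolding cube_def by blast
    define I where "I = (LINT x:Q|lebesgue. w x)"
    have Qint: "set_integrable lebesgue Q w" unfolding Q by (intro int compact_cbox)
    then have I: "(\<integral>\<^sup>+x\<in>Q. ennreal \<bar>w x\<bar> \<partial>lebesgue) = ennreal I"
      unfolding I_def set_integrable_def set_lebesgue_integral_def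
      by (subst nn_integral_eq_integral[symmetric])
         (auto simp: w indicator_def intro!: nn_integral_cong)
    have "0 \<le> I" unfolding I_def set_lebesgue_integral_def by (simp add: w)
    have "I / l ^ n / C \<le> w x" if x: "x \<in> Q" "maximal_function w x \<le> ennreal (D * w x)" for x
    proof -
      define r where "r = 2 * real n * l"
      have "0 < r" using l n by (simp add: r_def)
      have "emeasure lebesgue (ball x r) \<le> emeasure lebesgue (cbox (x - (\<chi> i. r)) ((x - (\<chi> i. r)) + (\<chi> i. 2 * r)))"
        by (intro emeasure_mono ball_subset_cube) auto
      also have "\<dots> = ennreal ((2 * r) ^ n)"
        using measure_cube[of "2 * r" "x - (\<chi> i. r)"] \<open>0 < r\<close>
        by (subst emeasure_eq_measure2) (auto simp: n_def)
      finally have V: "emeasure lebesgue (ball x r) \<le> ennreal ((2 * r) ^ n)" .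
      have "ennreal (I / (2 * r) ^ n) = ennreal I / ennreal ((2 * r) ^ n)"
        using \<open>0 \<le> I\<close> \<open>0 < r\<close> by (simp add: divide_ennreal)
      also have "\<dots> \<le> (\<integral>\<^sup>+y\<in>ball x r. ennreal \<bar>w y\<bar> \<partial>lebesgue) / emeasure lebesgue (ball x r)"
        unfolding I[symmetric] divide_ennreal_def
        using cube_subset_ball[OF l x(1)[unfolded Q]] V
        by (intro mult_mono nn_integral_mono ennreal_inverse_antimono)
           (auto simp: indicator_def Q r_def n_def)
      also have "\<dots> \<le> ennreal (D * w x)"
        using maximal_function_ball_le[OF \<open>0 < r\<close>] x(2) by (rule order_trans)
      finally have "I / (2 * r) ^ n \<le> D * w x" using w[of x] D by simp
      then have "I / (2 * r) ^ n / D \<le> w x"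
        by (simp only: pos_divide_le_eq[OF D] mult.commute)
      moreover have "I / l ^ n / C = I / (2 * r) ^ n / D"
        by (simp add: r_def C_def power_mult_distrib)
      ultimately show ?thesis by (simp only:)
    qed
    then have "AE x in lebesgue. x \<in> Q \<longrightarrow> - ereal (w x) \<le> - ereal (I / l ^ n / C)"
      using M by (auto elim!: eventually_mono)
    then have "AE x in lebesgue_on Q. - ereal (w x) \<le> - ereal (I / l ^ n / C)"
      by (subst AE_restrict_space_iff) (auto simp: Q)
    then have "esssup (lebesgue_on Q) (\<lambda>x. - ereal (w x)) \<le> - ereal (I / l ^ n / C)"
      by (intro esssup_I measurable_restrict_space1) measurable
    then have "ereal (I / l ^ n / C) \<le> essinf (lebesgue_on Q) (\<lambda>x. ereal (w x))"
      unfolding essinf_def by (metis ereal_minus_le_minus ereal_uminus_uminus)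
    then have "ereal C * ereal (I / l ^ n / C) \<le> ereal C * essinf (lebesgue_on Q) (\<lambda>x. ereal (w x))"
      using C by (intro ereal_mult_left_mono) auto
    moreover have "measure lebesgue Q = l ^ n" using measure_cube[of l a] l by (simp add: Q n_def)
    ultimately show "ereal ((LINT x:Q|lebesgue. w x) / measure lebesgue Q)
        \<le> ereal C * essinf (lebesgue_on Q) (\<lambda>x. ereal (w x))"
      using C by (simp add: I_def)
  qed
  then show ?thesis
    using int w by (auto simp: A1_weight_def weight_def)
qed

text \<open>Countable subadditivity, from interchanging sum and integral on each ball. Where the
  series diverges, \<open>enn2real\<close> returns 0, which only lowers the left-hand side.\<close>

lemma maximal_function_enn2real_suminf_le:
  assumes [measurable]: "\<And>k. h k \<in> borel_measurable lebesgue"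
    and h: "\<And>k x. 0 \<le> h k x" and c: "\<And>k. 0 \<le> c k"
  shows "maximal_function (\<lambda>x. enn2real (\<Sum>k. ennreal (c k * h k x))) x
    \<le> (\<Sum>k. ennreal (c k) * maximal_function (h k) x)"
  unfolding maximal_function_def[of "\<lambda>x. enn2real (\<Sum>k. ennreal (c k * h k x))"]
proof (rule SUP_least)
  fix r :: real assume "r \<in> {0<..}"
  then have "0 < r" by simp
  have [measurable]: "ball x r \<in> sets lebesgue" by simp
  let ?V = "emeasure lebesgue (ball x r)"
  have "(\<integral>\<^sup>+y\<in>ball x r. ennreal \<bar>enn2real (\<Sum>k. ennreal (c k * h k y))\<bar> \<partial>lebesgue)
      \<le> (\<integral>\<^sup>+y. (\<Sum>k. ennreal (c k) * (ennreal \<bar>h k y\<bar> * indicator (ball x r) y)) \<partial>lebesgue)"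
    using h c by (intro nn_integral_mono)
      (auto simp: indicator_def ennreal_enn2real_if ennreal_mult)
  also have "\<dots> = (\<Sum>k. ennreal (c k) * (\<integral>\<^sup>+y\<in>ball x r. ennreal \<bar>h k y\<bar> \<partial>lebesgue))"
    by (subst nn_integral_suminf) (auto simp: nn_integral_cmult)
  finally have "(\<integral>\<^sup>+y\<in>ball x r. ennreal \<bar>enn2real (\<Sum>k. ennreal (c k * h k y))\<bar> \<partial>lebesgue) / ?V
      \<le> (\<Sum>k. ennreal (c k) * (\<integral>\<^sup>+y\<in>ball x r. ennreal \<bar>h k y\<bar> \<partial>lebesgue)) / ?V"
    by (rule divide_right_mono_ennreal)
  also have "\<dots> = (\<Sum>k. ennreal (c k) * ((\<integral>\<^sup>+y\<in>ball x r. ennreal \<bar>h k y\<bar> \<partial>lebesgue) / ?V))"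
    by (simp only: ennreal_times_divide ennreal_suminf_divide)
  also have "\<dots> \<le> (\<Sum>k. ennreal (c k) * maximal_function (h k) x)"
    by (intro suminf_le mult_left_mono maximal_function_ball_le[OF \<open>0 < r\<close>]) auto
  finally show "(\<integral>\<^sup>+y\<in>ball x r. ennreal \<bar>enn2real (\<Sum>k. ennreal (c k * h k y))\<bar> \<partial>lebesgue) / ?V
      \<le> (\<Sum>k. ennreal (c k) * maximal_function (h k) x)" .
qed


section \<open>The Rubio de Francia iteration\<close>

lemma maximal_bounded_exponentsE:
  assumes "s \<in> maximal_bounded_exponents"
  obtains B :: real where "1 \<le> B"
    "\<And>f b. f \<in> borel_measurable lebesgue \<Longrightarrow> 0 < b \<Longrightarrow> modular s (\<lambda>x. f x / b) \<le> 1 \<Longrightarrow>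
      (AE x in lebesgue. maximal_function f x < \<infinity>) \<and>
      (\<lambda>x. enn2real (maximal_function f x)) \<in> borel_measurable lebesgue \<and>
      modular s (\<lambda>x. enn2real (maximal_function f x) / (B * b)) \<le> 1"
proof -
  obtain C :: real where C: "\<And>f. f \<in> var_Lp s \<Longrightarrow>
      (AE x in lebesgue. maximal_function f x < \<infinity>) \<and>
      var_norm s (\<lambda>x. enn2real (maximal_function f x)) \<le> ennreal C * var_norm s f"
    and s: "\<And>x. 1 \<le> s x"
    using assms unfolding maximal_bounded_exponents_def by blast
  \<comment> \<open>The constant \<open>C\<close> may be negative, hence the \<open>max\<close>.
    Adding 1 makes the norm inequality strict, so that the modular at the divisor itself is at most
    1; it also supplies measurability, since \<open>var_norm\<close> is infinite off the
    space.\<close>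
  show thesis
  proof (rule that[of "max C 0 + 1"])
    fix f b assume f: "f \<in> borel_measurable lebesgue" "0 < b" "modular s (\<lambda>x. f x / b) \<le> 1"
    note f' = var_norm_leI[OF f]
    have "var_norm s (\<lambda>x. enn2real (maximal_function f x)) \<le> ennreal C * var_norm s f"
      using C[OF f'(1)] by simp
    also have "\<dots> \<le> ennreal C * ennreal b" by (intro mult_left_mono f') simp
    also have "\<dots> = ennreal (max C 0 * b)"
      using \<open>0 < b\<close> by (cases "0 \<le> C") (auto simp: ennreal_mult max_def ennreal_neg)
    also have "\<dots> < ennreal ((max C 0 + 1) * b)"
      using \<open>0 < b\<close> by (simp add: ennreal_less_iff algebra_simps)
    finally have less: "var_norm s (\<lambda>x. enn2real (maximal_function f x)) < ennreal ((max C 0 + 1) * b)" .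
    have "0 \<le> s x" for x using s[of x] by linarith
    from var_norm_lessD[OF this _ less] \<open>0 < b\<close> C[OF f'(1)]
    show "(AE x in lebesgue. maximal_function f x < \<infinity>) \<and>
      (\<lambda>x. enn2real (maximal_function f x)) \<in> borel_measurable lebesgue \<and>
      modular s (\<lambda>x. enn2real (maximal_function f x) / ((max C 0 + 1) * b)) \<le> 1"
      by auto
  qed simp
qed

text \<open>Since \<open>s\<close> is at least 1, a factor in [0,1] raised to \<open>s x\<close> is
  at most itself and leaves the modular unchanged.\<close>

lemma modular_power_half_le:
  assumes [measurable]: "s \<in> borel_measurable lebesgue" "f \<in> borel_measurable lebesgue"
    and s: "\<And>x. 1 \<le> s x" and m: "modular s f \<le> 1"
  shows "modular s (\<lambda>x. (1/2) ^ k * f x) \<le> ennreal ((1/2) ^ k)"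
proof -
  have le1: "((1/2::real) ^ k) \<le> 1" by (rule power_le_one) auto
  have "modular s (\<lambda>x. (1/2) ^ k * f x) \<le> ennreal ((1/2) ^ k) * modular s f"
    using powr_mono'[OF s _ le1] by (intro modular_cmult_le) auto
  also have "\<dots> \<le> ennreal ((1/2) ^ k) * 1" by (intro mult_left_mono m) simp
  finally show ?thesis by simp
qed

lemma term_le_enn2real_suminf:
  fixes a :: "nat \<Rightarrow> real"
  assumes "(\<Sum>k. ennreal (a k)) < \<infinity>"
  shows "a k \<le> enn2real (\<Sum>k. ennreal (a k))"
proof -
  have "ennreal (a k) \<le> (\<Sum>k. ennreal (a k))"
    using sum_le_suminf[OF summableI, of "{k}" "\<lambda>k. ennreal (a k)"] by simp
  also have "\<dots> = ennreal (enn2real (\<Sum>k. ennreal (a k)))" using assms by simp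
  finally show ?thesis by (simp del: ennreal_enn2real)
qed

text \<open>The Rubio de Francia algorithm: \<open>w = \<Sum>k. M\<^sup>k h / (4 (4 B)\<^sup>k)\<close>, so that \<open>M w \<le> 4 B w\<close>.\<close>

lemma rubio_de_francia:
  fixes h :: "real^'n \<Rightarrow> real"
  assumes sB: "s \<in> maximal_bounded_exponents"
    and h: "h \<in> borel_measurable lebesgue" "\<And>x. 0 \<le> h x" "modular s (\<lambda>x. h x / 2) \<le> 1"
  obtains w where "A1_weight w" "modular s w \<le> 2" "AE x in lebesgue. h x \<le> 4 * w x"
proof -
  have [measurable]: "s \<in> borel_measurable lebesgue" and s: "\<And>x. 1 \<le> s x"
    using sB by (auto simp: maximal_bounded_exponents_def)
  have s0: "0 < s x" for x using s[of x] by linarith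
  obtain B where B: "1 \<le> B" and maxB:
    "\<And>f b. f \<in> borel_measurable lebesgue \<Longrightarrow> 0 < b \<Longrightarrow> modular s (\<lambda>x. f x / b) \<le> 1 \<Longrightarrow>
      (AE x in lebesgue. maximal_function f x < \<infinity>) \<and>
      (\<lambda>x. enn2real (maximal_function f x)) \<in> borel_measurable lebesgue \<and>
      modular s (\<lambda>x. enn2real (maximal_function f x) / (B * b)) \<le> 1"
    using maximal_bounded_exponentsE[OF sB] by metis
  define H where "H k = ((\<lambda>f x. enn2real (maximal_function f x)) ^^ k) h" for k
  have H_Suc: "H (Suc k) = (\<lambda>x. enn2real (maximal_function (H k) x))" for k
    by (simp add: H_def)
  have H0: "0 \<le> H k x" for k x by (cases k) (auto simp: H_def h)
  have Hk: "H k \<in> borel_measurable lebesgue \<and> modular s (\<lambda>x. H k x / (2 * B ^ k)) \<le> 1" for k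
  proof (induction k)
    case 0
    then show ?case using h by (simp add: H_def)
  next
    case (Suc k)
    then show ?case
      using maxB[of "H k" "2 * B ^ k"] B by (simp add: H_Suc ac_simps)
  qed
  then have [measurable]: "H k \<in> borel_measurable lebesgue" for k by simp
  \<comment> \<open>\<open>enn2real\<close> in \<open>H\<close> turns infinite values into 0. Off
    one null set the maximal function of every \<open>H k\<close> is finite and therefore agrees
    with \<open>H (Suc k)\<close>.\<close>
  have MH: "AE x in lebesgue. \<forall>k. maximal_function (H k) x < \<infinity>"
    unfolding AE_all_countable using maxB[of "H k" "2 * B ^ k" for k] Hk B by simp
  define c where "c k = 1 / (4 * (4 * B) ^ k)" for k
  have c: "0 \<le> c k" for k using B by (simp add: c_def)
  \<comment> \<open>The iterate is normalised to modular at most 1 before the factor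
    \<open>(1/2) ^ k\<close>. Together with \<open>(1/2) ^ Suc k\<close> from the summation lemma
    this produces exactly \<open>c k\<close>.\<close>
  define a where "a k x = (1/2) ^ k * (H k x / (2 * B ^ k))" for k x
  have ac: "(1/2) ^ Suc k * a k x = c k * H k x" for k x
    by (simp add: a_def c_def power_mult_distrib power_divide flip: power_add mult_2)
      (simp add: power_mult_distrib[symmetric] power_add mult_2)
  define W where "W x = (\<Sum>k. ennreal (c k * H k x))" for x
  define w where "w x = enn2real (W x)" for x
  have ma: "modular s (a k) \<le> ennreal ((1/2) ^ k)" for k
    unfolding a_def using Hk by (intro modular_power_half_le s) auto
  have a0: "0 \<le> a k x" for k x using H0 B by (simp add: a_def)
  have [measurable]: "a k \<in> borel_measurable lebesgue" for k unfolding a_def by measurable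
  note W = modular_suminf[of s a, OF _ _ s0 a0 ma, unfolded ac, folded W_def]
  have fin: "AE x in lebesgue. W x < \<infinity>" by (rule W) auto
  have "modular s w \<le> 2" unfolding w_def by (rule W) auto
  have [measurable]: "w \<in> borel_measurable lebesgue" unfolding w_def W_def by measurable
  have "AE x in lebesgue. maximal_function w x \<le> ennreal (4 * B * w x)"
    using MH fin
  proof eventually_elim
    fix x assume x: "\<forall>k. maximal_function (H k) x < \<infinity>" "W x < \<infinity>"
    have "maximal_function w x \<le> (\<Sum>k. ennreal (c k) * maximal_function (H k) x)"
      unfolding w_def W_def using H0 c by (intro maximal_function_enn2real_suminf_le) auto
    \<comment> \<open>Index shift: \<open>c k\<close> is \<open>4 * B\<close> times
      \<open>c (Suc k)\<close>, so what remains is \<open>4 * B\<close> times the series for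
      \<open>W\<close> without its first term.\<close>
    also have "\<dots> = (\<Sum>k. ennreal (4 * B) * ennreal (c (Suc k) * H (Suc k) x))"
    proof (rule suminf_cong)
      fix k
      have "maximal_function (H k) x = ennreal (H (Suc k) x)" using x by (simp add: H_Suc)
      moreover have "c k = 4 * B * c (Suc k)" using B by (simp add: c_def)
      ultimately show "ennreal (c k) * maximal_function (H k) x = ennreal (4 * B) * ennreal (c (Suc k) * H (Suc k) x)"
        using c H0 B by (simp add: mult.assoc flip: ennreal_mult)
    qed
    also have "\<dots> = ennreal (4 * B) * (\<Sum>k. ennreal (c (Suc k) * H (Suc k) x))" by simp
    also have "\<dots> \<le> ennreal (4 * B) * W x"
      unfolding W_def
      using suminf_offset[OF summableI, of "\<lambda>k. ennreal (c k * H k x)" 1]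
      by (intro mult_left_mono) auto
    also have "\<dots> = ennreal (4 * B * w x)"
      using x B by (simp add: w_def ennreal_mult)
    finally show "maximal_function w x \<le> ennreal (4 * B * w x)" .
  qed
  then have "A1_weight w"
    using B by (intro A1_weight_if_maximal_function_le) (auto simp: w_def)
  moreover have "AE x in lebesgue. h x \<le> 4 * w x"
    using fin
  proof eventually_elim
    fix x assume "W x < \<infinity>"
    then show "h x \<le> 4 * w x"
      \<comment> \<open>The term of index 0 is h/4, whence the factor 4.\<close>
      using term_le_enn2real_suminf[of "\<lambda>k. c k * H k x" 0]
      by (simp add: w_def W_def c_def H_def)
  qed
  ultimately show thesis using that \<open>modular s w \<le> 2\<close> by blast
qed

text \<open>\<open>G k\<close> enters the sum \<open>h\<close> with coefficient 1/(2 * 4^k), and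
  \<open>h\<close> is at most \<open>4 * w\<close>; this accounts for the factor
  \<open>8 * 4 ^ k\<close>. One weight for all \<open>k\<close> means one \<open>A1\<close>
  constant.\<close>

lemma common_A1_majorant:
  fixes G :: "nat \<Rightarrow> real^'n \<Rightarrow> real"
  assumes sB: "s \<in> maximal_bounded_exponents"
    and G[measurable]: "\<And>k. G k \<in> borel_measurable lebesgue" and G0: "\<And>k x. 0 \<le> G k x"
    and m: "\<And>k. modular s (G k) \<le> 1"
  obtains w where "A1_weight w" "modular s w \<le> 2"
    "\<And>k. AE x in lebesgue. G k x \<le> 8 * 4 ^ k * w x"
proof -
  have [measurable]: "s \<in> borel_measurable lebesgue" and s: "\<And>x. 1 \<le> s x"
    using sB by (auto simp: maximal_bounded_exponents_def)
  have s0: "0 < s x" for x using s[of x] by linarith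
  define a where "a k x = (1/2) ^ k * G k x" for k x
  have ma: "modular s (a k) \<le> ennreal ((1/2) ^ k)" for k
    unfolding a_def by (intro modular_power_half_le s m) auto
  have a0: "0 \<le> a k x" for k x using G0 by (simp add: a_def)
  have [measurable]: "a k \<in> borel_measurable lebesgue" for k unfolding a_def by measurable
  define W where "W x = (\<Sum>k. ennreal ((1/2) ^ Suc k * a k x))" for x
  define h where "h x = enn2real (W x)" for x
  have [measurable]: "h \<in> borel_measurable lebesgue" unfolding h_def W_def by measurable
  note W = modular_suminf[of s a, OF _ _ s0 a0 ma, folded W_def]
  have fin: "AE x in lebesgue. W x < \<infinity>" by (rule W) auto
  \<comment> \<open>Halving brings the modular from 2 to 1, as required for starting the iteration;
    this uses that \<open>s\<close> is at least 1.\<close>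
  have "modular s (\<lambda>x. (1/2) * h x) \<le> ennreal (1/2) * modular s h"
    using powr_mono'[OF s, of "1/2"] by (intro modular_cmult_le) auto
  also have "\<dots> \<le> ennreal (1/2) * ennreal 2"
    unfolding h_def by (intro mult_left_mono order_trans[OF W(2)]) auto
  also have "\<dots> = 1" by (subst ennreal_mult[symmetric]) auto
  finally have "modular s (\<lambda>x. h x / 2) \<le> 1" by simp
  then obtain w where w: "A1_weight w" "modular s w \<le> 2" "AE x in lebesgue. h x \<le> 4 * w x"
    using rubio_de_francia[OF sB, of h] by (auto simp: h_def)
  have "AE x in lebesgue. G k x \<le> 8 * 4 ^ k * w x" for k
    using fin w(3)
  proof eventually_elim
    fix x assume x: "W x < \<infinity>" "h x \<le> 4 * w x"
    have "G k x = 2 * 4 ^ k * ((1/2) ^ Suc k * a k x)"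
      by (simp add: a_def power_divide flip: power_mult_distrib)
    also have "\<dots> \<le> 2 * 4 ^ k * h x"
      using x(1) term_le_enn2real_suminf[of "\<lambda>k. (1/2) ^ Suc k * a k x" k]
      by (intro mult_left_mono) (auto simp: h_def W_def)
    also have "\<dots> \<le> 2 * 4 ^ k * (4 * w x)" by (intro mult_left_mono x) auto
    finally show "G k x \<le> 8 * 4 ^ k * w x" by simp
  qed
  from w(1,2) this show thesis by (rule that)
qed


section \<open>Reduction of the quasi-norm, and weighted integrals against modulars\<close>

lemma var_Lp0_eq:
  fixes p :: "real^'n \<Rightarrow> real"
  assumes [measurable]: "p \<in> borel_measurable lebesgue"
    and p: "\<And>x. a \<le> p x" "\<And>x. p x \<le> b" "0 < a"
  shows "var_Lp0 p = var_Lp p" "var_norm0 p f = var_norm p f"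
proof -
  have "esssup lebesgue (\<lambda>x. - ereal (p x)) \<le> - ereal a"
    using p(1) by (intro esssup_I) auto
  then have lower: "ereal a \<le> exp_minus p"
    unfolding exp_minus_def essinf_def by (metis ereal_minus_le_minus ereal_uminus_uminus)
  obtain x where "- ereal (p x) \<le> esssup lebesgue (\<lambda>x. - ereal (p x))"
    using eventually_happens[OF esssup_AE[of "\<lambda>x. - ereal (p x)" lebesgue]]
    by (auto simp: ae_filter_eq_bot_iff)
  then have "exp_minus p \<le> ereal (p x)"
    unfolding exp_minus_def essinf_def by (metis ereal_uminus_le_reorder)
  \<comment> \<open>Lying between \<open>a\<close> and a value of \<open>p\<close>,
    \<open>exp_minus p\<close> is a positive real, so \<open>real_of_ereal\<close> does not return
    its default 0 and the auxiliary parameter is admissible.\<close>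
  with lower p(3) have "0 < real_of_ereal (exp_minus p) / 2"
    by (cases "exp_minus p") auto
  then show "var_Lp0 p = var_Lp p" "var_norm0 p f = var_norm p f"
    by (simp_all add: var_Lp0_def var_norm0_def var_Lp_aux_eq var_norm_aux_eq)
qed

text \<open>Serves both sides of the weighted estimate: with \<open>q\<close> and
  \<open>a = q0\<close> it makes the left-hand side finite, with \<open>p\<close> and
  \<open>a = p0\<close> it bounds the right-hand side. The factor \<open>l powr a\<close> is
  homogeneity.\<close>

lemma nn_integral_powr_mult_le_scaled:
  assumes [measurable]: "p \<in> borel_measurable lebesgue" "s \<in> borel_measurable lebesgue"
      "f \<in> borel_measurable lebesgue" "w \<in> borel_measurable lebesgue"
    and nonneg: "\<And>x. 0 \<le> f x" "\<And>x. 0 \<le> w x"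
    and a: "0 < a" "\<And>x. a < p x" and b: "\<And>x. s x * (1 - a / p x) = b" and l: "0 < l"
  shows "(\<integral>\<^sup>+x. ennreal (f x powr a * w x powr b) \<partial>lebesgue)
    \<le> ennreal (l powr a) * (modular p (\<lambda>x. f x / l) + modular s w)"
proof -
  have "f x powr a * w x powr b = l powr a * ((f x / l) powr a * w x powr b)" for x
    using l nonneg by (simp add: powr_divide)
  then have "(\<integral>\<^sup>+x. ennreal (f x powr a * w x powr b) \<partial>lebesgue)
      = ennreal (l powr a) * (\<integral>\<^sup>+x. ennreal ((f x / l) powr a * w x powr b) \<partial>lebesgue)"
    by (simp only: ennreal_mult' powr_ge_zero) (rule nn_integral_cmult, measurable)
  also have "\<dots> \<le> ennreal (l powr a) * (modular p (\<lambda>x. f x / l) + modular s w)"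
    using nonneg l by (intro mult_left_mono nn_integral_powr_mult_le a b) auto
  finally show ?thesis .
qed

text \<open>This takes the place of duality: split the \<open>q x\<close>-th power of
  \<open>f x / l\<close> into the powers \<open>a\<close> and \<open>q x - a\<close>, and dominate
  the second one by \<open>(b * w x) powr d\<close>.\<close>

lemma nn_integral_powr_mult_ge:
  assumes [measurable]: "q \<in> borel_measurable lebesgue" "f \<in> borel_measurable lebesgue"
      "w \<in> borel_measurable lebesgue"
    and nonneg: "\<And>x. 0 \<le> f x" "\<And>x. 0 \<le> w x"
    and pos: "0 < l" "0 < b" "0 < d"
    and le: "AE x in lebesgue. (f x / l) powr ((q x - a) / d) \<le> b * w x"
    and ge1: "1 \<le> modular q (\<lambda>x. f x / l)"
  shows "ennreal (l powr a * b powr - d) \<le> (\<integral>\<^sup>+x. ennreal (f x powr a * w x powr d) \<partial>lebesgue)"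
proof -
  let ?c = "l powr a * b powr - d"
  have "ennreal ?c * 1 \<le> ennreal ?c * modular q (\<lambda>x. f x / l)"
    by (intro mult_left_mono ge1) simp
  also have "\<dots> = (\<integral>\<^sup>+x. ennreal (?c * (f x / l) powr q x) \<partial>lebesgue)"
    using nonneg pos
    by (simp add: modular_def ennreal_mult' flip: nn_integral_cmult)
  also have "\<dots> \<le> (\<integral>\<^sup>+x. ennreal (f x powr a * w x powr d) \<partial>lebesgue)"
  proof (rule nn_integral_mono_AE, rule AE_mp[OF le], intro AE_I2 impI ennreal_leI)
    fix x assume x: "(f x / l) powr ((q x - a) / d) \<le> b * w x"
    have "(f x / l) powr (q x - a) = ((f x / l) powr ((q x - a) / d)) powr d"
      using pos by (simp add: powr_powr)
    also have "\<dots> \<le> (b * w x) powr d" using x pos by (intro powr_mono2) auto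
    finally have "(f x / l) powr (q x - a) \<le> b powr d * w x powr d"
      using pos nonneg by (simp add: powr_mult)
    then have "?c * ((f x / l) powr a * (f x / l) powr (q x - a))
        \<le> ?c * ((f x / l) powr a * (b powr d * w x powr d))"
      by (intro mult_left_mono) auto
    then show "?c * (f x / l) powr q x \<le> f x powr a * w x powr d"
      using pos nonneg by (simp add: powr_divide powr_minus field_simps flip: powr_add)
  qed
  finally show ?thesis by simp
qed

theorem theorem1p4:
  fixes F :: "((real^'n \<Rightarrow> real) \<times> (real^'n \<Rightarrow> real)) set"
    and p0 q0 \<delta> :: real
    and p q :: "real^'n \<Rightarrow> real"
    and C0 :: "real \<Rightarrow> real"
  assumes F: "\<And>f g. (f, g) \<in> F \<Longrightarrow>
      f \<in> borel_measurable lebesgue \<and> g \<in> borel_measurable lebesgue \<and> (\<forall>x. 0 \<le> f x \<and> 0 \<le> g x)"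
    and "0 < p0" and "p0 \<le> q0" and "0 < \<delta>" and "\<delta> < 1"
    and "\<And>t. 0 < C0 t"
    and weighted: "\<And>w f g. A1_weight w \<Longrightarrow> (f, g) \<in> F \<Longrightarrow>
      (\<integral>\<^sup>+x. ennreal (f x powr q0 * w x powr \<delta>) \<partial>lebesgue) erpow (1 / q0) < \<infinity> \<Longrightarrow>
      (\<integral>\<^sup>+x. ennreal (f x powr q0 * w x powr \<delta>) \<partial>lebesgue) erpow (1 / q0)
        \<le> ennreal (C0 (A1_const w)) *
          (\<integral>\<^sup>+x. ennreal (g x powr p0 * w x powr (\<delta> * p0 / q0)) \<partial>lebesgue) erpow (1 / p0)"
    and "p \<in> exponents0"
    and "ereal p0 < exp_minus p" and "exp_minus p \<le> exp_plus p"
    and "exp_plus p < ereal (p0 * q0 / (q0 - \<delta> * p0))"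
    and q: "\<And>x. 1 / p x - 1 / q x = 1 / p0 - 1 / q0"
    and "(\<lambda>x. \<delta> * conj_exponent (\<lambda>y. q y / q0) x) \<in> maximal_bounded_exponents"
  shows "\<exists>C::real. 0 < C \<and>
    (\<forall>(f, g)\<in>F. f \<in> var_Lp0 q \<longrightarrow> var_norm0 q f \<le> ennreal C * var_norm0 p g)"
proof -

  \<comment> \<open>Pointwise bounds and identities for the exponents\<close>
  note p0 = \<open>0 < p0\<close> and C0_pos = \<open>\<And>t. 0 < C0 t\<close> and \<delta> = \<open>0 < \<delta>\<close> \<open>\<delta> < 1\<close>
  have q0: "0 < q0" using p0 \<open>p0 \<le> q0\<close> by linarith
  define s where "s x = \<delta> * conj_exponent (\<lambda>y. q y / q0) x" for x
  have sB: "s \<in> maximal_bounded_exponents"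
    unfolding s_def by fact
  have s_meas[measurable]: "s \<in> borel_measurable lebesgue" and s1: "\<And>x. 1 \<le> s x"
    using sB by (auto simp: maximal_bounded_exponents_def)
  have p_meas[measurable]: "p \<in> borel_measurable lebesgue" and p_pos: "\<And>x. 0 < p x"
    using \<open>p \<in> exponents0\<close> by (auto simp: exponents0_def)
  define b where "b = q0 / (1 - \<delta>)"
  have q_bounds: "q0 < q x \<and> q x \<le> b \<and> s x * (1 - q0 / q x) = \<delta>" for x
  proof -
    define u where "u = 1 - q0 / q x"
    \<comment> \<open>Since \<open>s x\<close> is at least 1, \<open>u\<close> must be positive: by
      the division convention u = 0 would give s = 0. Then u \<le> \<delta> < 1 yields the upper
      bound \<open>b\<close>; it also excludes q = 0, where u would be 1.\<close>
    have s_eq: "s x = \<delta> / u" by (simp add: s_def conj_exponent_def u_def)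
    then have u: "0 < u" "u \<le> \<delta>"
      using s1[of x] \<delta> by (auto simp: le_divide_eq_1 zero_less_mult_iff split: if_splits)
    then have *: "q0 / q x < 1" "1 - \<delta> \<le> q0 / q x" by (auto simp: u_def)
    then have "0 < q0 / q x" using \<delta> by linarith
    then have "0 < q x" using q0 by (simp add: zero_less_divide_iff)
    with * \<delta> have "q0 < q x" "q x \<le> b" by (auto simp: b_def field_simps)
    with u show ?thesis by (simp add: s_eq flip: u_def)
  qed
  then have q_lower: "q0 < q x" and q_upper: "q x \<le> b" and s_q: "s x * (1 - q0 / q x) = \<delta>" for x
    by auto
  have q_pos: "0 < q x" for x using q_lower[of x] q0 by linarith
  have p_inv: "1 / p x = 1 / q x + (1 / p0 - 1 / q0)" for x using q[of x] by simp
  have p_lower: "p0 < p x" for x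
  proof -
    have "1 / q x < 1 / q0" using q_lower[of x] q0 by (simp add: divide_strict_left_mono)
    then have "1 / p x < 1 / p0" using p_inv[of x] by linarith
    then show ?thesis using p0 p_pos[of x] by (simp add: field_simps)
  qed
  have p_upper: "p x \<le> b" for x
  proof -
    have "1 / q0 \<le> 1 / p0" using p0 \<open>p0 \<le> q0\<close> by (simp add: field_simps)
    then have "1 / q x \<le> 1 / p x" using p_inv[of x] by linarith
    then have "p x \<le> q x" using p_pos[of x] q_pos[of x] by (simp add: field_simps)
    then show ?thesis using q_upper[of x] by linarith
  qed
  \<comment> \<open>The relation between \<open>p\<close> and \<open>q\<close> amounts to 1 - p0/p =
    (p0/q0)(1 - q0/q). Hence the same \<open>s\<close> governs the right-hand side, where the weight
    has exponent \<delta> p0/q0.\<close>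
  have s_p: "s x * (1 - p0 / p x) = \<delta> * p0 / q0" for x
  proof -
    have "1 - p0 / p x = 1 - p0 * (1 / p x)" by simp
    also have "\<dots> = p0 / q0 * (1 - q0 / q x)"
      unfolding p_inv using p0 q0 q_pos[of x] by (simp add: field_simps)
    finally have "s x * (1 - p0 / p x) = p0 / q0 * (s x * (1 - q0 / q x))"
      by (simp only: mult.left_commute)
    then show ?thesis unfolding s_q by simp
  qed
  have "q = (\<lambda>x. 1 / (1 / p x - (1 / p0 - 1 / q0)))"
    using p_inv by (simp add: fun_eq_iff)
  then have q_meas[measurable]: "q \<in> borel_measurable lebesgue" by simp
  note q_norm = var_Lp0_eq[OF q_meas less_imp_le[OF q_lower] q_upper q0]
  note p_norm = var_Lp0_eq[OF p_meas less_imp_le[OF p_lower] p_upper p0]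

  \<comment> \<open>Growing constants and a sequence of pairs violating the conclusion\<close>
  define K where "K = 2 powr b"
  have b: "0 < b" using q0 \<delta> by (simp add: b_def)
  then have K: "1 \<le> K" unfolding K_def by (intro ge_one_powr_ge_zero) auto
  \<comment> \<open>\<open>K\<close> bounds the modulars of the normalised functions and will be
    divided out of \<open>G\<close>; \<open>8 * 4 ^ k\<close> is the loss in the common
    majorant.\<close>
  define \<beta> :: "nat \<Rightarrow> real" where "\<beta> k = K * (8 * 4 ^ k)" for k
  have \<beta>: "0 < \<beta> k" for k using K by (simp add: \<beta>_def)
  \<comment> \<open>The power of \<open>\<beta> k\<close> cancels the loss in the weighted estimate;
    the factor \<open>real k + 1\<close> survives and is unbounded.\<close>
  define c where "c k = (real k + 1) * \<beta> k powr (\<delta> / q0)" for k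
  have c: "0 < c k" for k using \<beta>[of k] by (simp add: c_def)

  show ?thesis
  proof (rule ccontr)
    assume contra: "\<not> ?thesis"
    have "\<exists>f g. (f, g) \<in> F \<and> f \<in> var_Lp q \<and> ennreal (c k) * var_norm p g < var_norm q f" for k
      using contra c[of k] unfolding q_norm p_norm by (force simp: not_le)
    then obtain f g where fg: "\<And>k. (f k, g k) \<in> F" and f_Lp: "\<And>k. f k \<in> var_Lp q"
      and less: "\<And>k. ennreal (c k) * var_norm p (g k) < var_norm q (f k)"
      by metis
    have f_meas[measurable]: "f k \<in> borel_measurable lebesgue" and f0: "0 \<le> f k x"
      and g_meas[measurable]: "g k \<in> borel_measurable lebesgue" and g0: "0 \<le> g k x" for k x
      using F[OF fg] by auto
    have "\<exists>l. 0 < l \<and> var_norm q (f k) \<le> ennreal (2 * l) \<and>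
        1 \<le> modular q (\<lambda>x. f k x / l) \<and> modular q (\<lambda>x. f k x / l) \<le> ennreal K" for k
    proof (rule var_norm_near_extremal[OF q_meas less_imp_le[OF q_lower] q_upper q0 f_Lp[of k]])
      show "0 < var_norm q (f k)" using less[of k] by (rule le_less_trans[OF zero_le])
    qed (auto simp: K_def)
    then obtain l where l: "\<And>k. 0 < l k" and norm_l: "\<And>k. var_norm q (f k) \<le> ennreal (2 * l k)"
      and l1: "\<And>k. 1 \<le> modular q (\<lambda>x. f k x / l k)"
      and lK: "\<And>k. modular q (\<lambda>x. f k x / l k) \<le> ennreal K"
      by metis
    \<comment> \<open>The test function is \<open>f k x / l k\<close> to the power
      \<open>q x - q0\<close>, raised to 1/\<delta>. Since s (q - q0)/\<delta> = q, its modular for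
      \<open>s\<close> is that of \<open>f k / l k\<close> for \<open>q\<close>, at most
      \<open>K\<close>.\<close>
    define G where "G k x = 1 / K * (f k x / l k) powr ((q x - q0) / \<delta>)" for k x
    have [measurable]: "G k \<in> borel_measurable lebesgue" for k unfolding G_def by measurable
    have G_mod: "modular s (G k) \<le> 1" for k
    proof -
      have "(q x - q0) / \<delta> * s x = q x" for x
        using s_q[of x] q_pos[of x] \<delta> by (simp add: field_simps)
      then have eq: "modular s (\<lambda>x. (f k x / l k) powr ((q x - q0) / \<delta>)) = modular q (\<lambda>x. f k x / l k)"
        using l[of k] f0 by (simp add: modular_def powr_powr)
      have "(1 / K) powr s x \<le> 1 / K" for x using powr_mono'[OF s1[of x], of "1 / K"] K by simp
      then have "modular s (G k) \<le> ennreal (1 / K) * modular s (\<lambda>x. (f k x / l k) powr ((q x - q0) / \<delta>))"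
        unfolding G_def using K by (intro modular_cmult_le) auto
      also have "\<dots> \<le> ennreal (1 / K) * ennreal K"
        unfolding eq by (intro mult_left_mono lK) simp
      also have "\<dots> = 1" using K by (simp flip: ennreal_mult')
      finally show ?thesis .
    qed
    obtain w where A1: "A1_weight w" and w_mod: "modular s w \<le> 2"
      and Gw: "\<And>k. AE x in lebesgue. G k x \<le> 8 * 4 ^ k * w x"
      using common_A1_majorant[OF sB, of G] G_mod K by (auto simp: G_def)
    have w_meas[measurable]: "w \<in> borel_measurable lebesgue" and w0: "\<And>x. 0 \<le> w x"
      using A1 by (auto simp: A1_weight_def weight_def)
    \<comment> \<open>The constant is independent of \<open>k\<close> because \<open>w\<close> is.
      The 3 is 1 + 2, from the modulars of the normalised \<open>g k\<close> and of
      \<open>w\<close>.\<close>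
    define D where "D = C0 (A1_const w) * 3 powr (1 / p0)"
    have D: "0 < D" unfolding D_def using C0_pos by simp

    \<comment> \<open>A number \<open>\<mu>\<close> strictly above the norm of \<open>g k\<close> is
      used as divisor, which also covers a norm equal to 0.\<close>
    have le_D: "l k \<le> \<beta> k powr (\<delta> / q0) * D * \<mu>" if \<mu>: "0 < \<mu>" "var_norm p (g k) < ennreal \<mu>" for k \<mu>
    proof -
      let ?L = "\<integral>\<^sup>+x. ennreal (f k x powr q0 * w x powr \<delta>) \<partial>lebesgue"
      let ?R = "\<integral>\<^sup>+x. ennreal (g k x powr p0 * w x powr (\<delta> * p0 / q0)) \<partial>lebesgue"
      have "?L \<le> ennreal (l k powr q0) * (modular q (\<lambda>x. f k x / l k) + modular s w)"
        using q0 q_lower s_q l f0 w0 by (intro nn_integral_powr_mult_le_scaled) auto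
      also have "\<dots> < \<infinity>"
        using le_less_trans[OF lK[of k]] le_less_trans[OF w_mod]
        by (simp add: ennreal_mult_less_top)
      finally have "?L < \<infinity>" .
      \<comment> \<open>The weighted inequality is available only once its left-hand side is known
        to be finite.\<close>
      then have fin: "?L erpow (1 / q0) < \<infinity>" by (auto simp: ennreal_rpow_def)
      have "AE x in lebesgue. (f k x / l k) powr ((q x - q0) / \<delta>) \<le> \<beta> k * w x"
        using Gw[of k] K by (auto simp: G_def \<beta>_def field_simps elim!: eventually_mono)
      then have L_ge: "ennreal (l k powr q0 * \<beta> k powr - \<delta>) \<le> ?L"
        using l \<beta> \<delta> f0 w0 l1 by (intro nn_integral_powr_mult_ge[where q = q]) auto
      have R: "?R erpow (1 / p0) \<le> ennreal (3 powr (1 / p0) * \<mu>)"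
      proof -
        have p_nonneg: "0 \<le> p x" for x using p_pos[of x] by simp
        have "?R \<le> ennreal (\<mu> powr p0) * (modular p (\<lambda>x. g k x / \<mu>) + modular s w)"
          using p0 p_lower s_p \<mu> g0 w0 by (intro nn_integral_powr_mult_le_scaled) auto
        also have "\<dots> \<le> ennreal (\<mu> powr p0) * (1 + 2)"
          by (intro mult_left_mono add_mono w_mod var_norm_lessD[OF p_nonneg \<mu>]) auto
        also have "\<dots> = ennreal (\<mu> powr p0 * 3)" by (simp add: ennreal_mult)
        finally have "?R erpow (1 / p0) \<le> ennreal (\<mu> powr p0 * 3) erpow (1 / p0)"
          using p0 by (intro erpow_mono) auto
        then show ?thesis
          using p0 \<mu> by (simp add: ennreal_rpow_def powr_mult powr_powr mult.commute)
      qed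
      have "ennreal (l k / \<beta> k powr (\<delta> / q0)) = ennreal (l k powr q0 * \<beta> k powr - \<delta>) erpow (1 / q0)"
        using q0 l[of k] \<beta>[of k]
        by (simp add: ennreal_rpow_def powr_divide powr_powr powr_minus_divide)
      also have "\<dots> \<le> ?L erpow (1 / q0)"
        using q0 L_ge by (intro erpow_mono) auto
      also have "\<dots> \<le> ennreal (C0 (A1_const w)) * ?R erpow (1 / p0)"
        by (rule weighted[OF A1 fg fin])
      also have "\<dots> \<le> ennreal (C0 (A1_const w)) * ennreal (3 powr (1 / p0) * \<mu>)"
        using R by (rule mult_left_mono) simp
      also have "\<dots> = ennreal (D * \<mu>)"
        unfolding D_def mult.assoc by (rule ennreal_mult'[symmetric]) (rule less_imp_le[OF C0_pos])
      finally have "ennreal (l k / \<beta> k powr (\<delta> / q0)) \<le> ennreal (D * \<mu>)" .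
      then show ?thesis
        using D \<mu> \<beta>[of k] by (simp add: pos_divide_le_eq ac_simps)
    qed

    \<comment> \<open>Comparison of the growth rates\<close>
    have "real k + 1 < 2 * D" for k
    proof -
      have "var_norm p (g k) \<noteq> \<infinity>"
        using less[of k] c[of k] by (auto simp: ennreal_mult_top)
      then obtain \<gamma> where \<gamma>: "var_norm p (g k) = ennreal \<gamma>" "0 \<le> \<gamma>"
        by (cases "var_norm p (g k)") auto
      let ?X = "\<beta> k powr (\<delta> / q0) * D"
      have X: "0 < ?X" using D \<beta>[of k] by simp
      have "l k / ?X \<le> \<mu>" if "\<gamma> < \<mu>" for \<mu>
        using le_D[of \<mu> k] that \<gamma> X by (simp add: ennreal_less_iff pos_divide_le_eq ac_simps)
      \<comment> \<open>Letting \<open>\<mu>\<close> decrease to the norm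
        \<open>\<gamma>\<close>.\<close>
      then have "l k / ?X \<le> \<gamma>" by (rule dense_ge)
      then have "l k \<le> ?X * \<gamma>" using X by (simp add: pos_divide_le_eq ac_simps)
      moreover have "c k * \<gamma> < 2 * l k"
      proof -
        have "ennreal (c k * \<gamma>) < ennreal (2 * l k)"
          using less_le_trans[OF less norm_l, of k] \<gamma> c[of k] by (simp add: ennreal_mult)
        then show ?thesis using \<gamma> c[of k] by (simp add: ennreal_less_iff)
      qed
      ultimately have "c k * \<gamma> < 2 * ?X * \<gamma>" by linarith
      \<comment> \<open>Cancelling \<open>\<gamma>\<close> is legitimate: for
        \<open>\<gamma> = 0\<close> the strict inequality would read 0 < 0.\<close>
      then have "c k < 2 * ?X" using \<gamma>(2) by (rule mult_right_less_imp_less)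
      then have "\<beta> k powr (\<delta> / q0) * (real k + 1) < \<beta> k powr (\<delta> / q0) * (2 * D)"
        by (simp add: c_def ac_simps)
      then show ?thesis using \<beta>[of k] by (simp only: mult_less_cancel_left_pos powr_gt_zero)
    qed
    moreover obtain k where "2 * D < real k" using reals_Archimedean2 by blast
    ultimately show False by (smt (verit))
  qed
qed

end
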